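(* Let $(X,d)$ be an infinite metric space and let $\mathfrak{B}$ be a bornology on $X$ with a compact base such that $X\notin\mathfrak{B}$. The following statements are equivalent. (1) ONE has a winning strategy in the Gruenhage game $\mathsf{G}(\tau^s_{\mathfrak{B}})$. (2) ONE has a winning strategy in $\mathsf{CL}(\tau^s_{\mathfrak{B}})$. (3) ONE has a winning strategy in $\mathsf{CD}(\tau^s_{\mathfrak{B}})$. (4) ONE has a winning strategy in $\mathcal{O}_{\mathfrak{B}^s}(X)$.
   Context: A bornology on a set $X$ is a family $\mathfrak{B}$ of subsets of $X$ that covers $X$, is closed under finite unions and is closed under taking subsets. A base of $\mathfrak{B}$ is a subfamily $\mathfrak{B}_0\subseteq\mathfrak{B}$ such that every $B\in\mathfrak{B}$ is contained in some $B_0\in\mathfrak{B}_0$; it is a compact base if all its members are compact. For $B\subseteq X$ and $\delta>0$, $B^\delta=\bigcup_{x\in B}\{y\in X: d(x,y)<\delta\}$. $C(X)$ is the set of continuous functions $X\to\mathbb{R}$, and $\underline{0}$ is the zero function. The topology $\tau^s_{\mathfrak{B}}$ of strong uniform convergence on $\mathfrak{B}$ is the topology on $C(X)$ induced by the uniformity with base consisting of the sets $[B,\varepsilon]^s=\{(f,g): \exists\delta>0\ \forall x\in B^\delta,\ |f(x)-g(x)|<\varepsilon\}$, $B\in\mathfrak{B}$, $\varepsilon>0$. Games are played by ONE and TWO in rounds $n\in\mathbb{N}$; strategies are with full memory of the opponent's previous moves. - $\mathsf{G}(\tau^s_{\mathfrak{B}})$: in round $n$ ONE chooses an open neighbourhood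 $W_n$ of $\underline{0}$ in $(C(X),\tau^s_{\mathfrak{B}})$ and TWO chooses $f_n\in W_n$. ONE wins if $(f_n)$ converges to $\underline{0}$ in $(C(X),\tau^s_{\mathfrak{B}})$; otherwise TWO wins. - $\mathsf{CL}(\tau^s_{\mathfrak{B}})$: in round $n$ ONE chooses a nonempty open subset $W_n$ of $(C(X),\tau^s_{\mathfrak{B}})$ and TWO chooses $f_n\in W_n$. ONE wins if $\underline{0}\in\overline{\{f_n:n\in\mathbb{N}\}}$; otherwise TWO wins. - $\mathsf{CD}(\tau^s_{\mathfrak{B}})$: in round $n$ ONE chooses a nonempty open subset $W_n$ of $(C(X),\tau^s_{\mathfrak{B}})$ and TWO chooses $f_n\in W_n$. TWO wins if the set $\{f_n:n\in\mathbb{N}\}$ is closed and discrete; otherwise ONE wins. - $\mathcal{O}_{\mathfrak{B}^s}(X)$: in round $n$ ONE chooses $B_n\in\mathfrak{B}$ and TWO chooses an open set $U_n\subseteq X$, $U_n\ne X$, such that $B_n^{\delta_n}\subseteq U_n$ for some $\delta_n>0$. ONE wins if $\{U_n:n\in\mathbb{N}\}$ is an open $\mathfrak{B}^s$-cover of $X$, i.e. it covers $X$, does not contain $X$ as a member, and for every $B\in\mathfrak{B}$ there are $n$ and $\delta>0$ with $B^\delta\subseteq U_n$; otherwise TWO wins. *)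

theory Defs
  imports "HOL-Analysis.Analysis"
begin

section \<open>Bornologies\<close>

text \<open>The metric space $X$ is the universe of a type of class \<open>metric_space\<close>.\<close>

definition bornology :: "'a set set \<Rightarrow> bool" where
  "bornology \<BB> \<longleftrightarrow>
     \<Union>\<BB> = UNIV \<and>
     (\<forall>\<F>. \<F> \<subseteq> \<BB> \<and> finite \<F> \<longrightarrow> \<Union>\<F> \<in> \<BB>) \<and>
     (\<forall>B\<in>\<BB>. \<forall>A. A \<subseteq> B \<longrightarrow> A \<in> \<BB>)"

definition bornology_base :: "'a set set \<Rightarrow> 'a set set \<Rightarrow> bool" where
  "bornology_base \<BB> \<BB>\<^sub>0 \<longleftrightarrow> \<BB>\<^sub>0 \<subseteq> \<BB> \<and> (\<forall>B\<in>\<BB>. \<exists>B\<^sub>0\<in>\<BB>\<^sub>0. B \<subseteq> B\<^sub>0)"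

definition has_compact_base :: "'a::metric_space set set \<Rightarrow> bool" where
  "has_compact_base \<BB> \<longleftrightarrow> (\<exists>\<BB>\<^sub>0. bornology_base \<BB> \<BB>\<^sub>0 \<and> (\<forall>K\<in>\<BB>\<^sub>0. compact K))"

definition enlargement :: "'a::metric_space set \<Rightarrow> real \<Rightarrow> 'a set" where
  "enlargement B \<delta> = (\<Union>x\<in>B. ball x \<delta>)"


section \<open>The topology of strong uniform convergence\<close>

definition cont_funs :: "('a::metric_space \<Rightarrow> real) set" where
  "cont_funs = {f. continuous_on UNIV f}"

definition strong_entourage ::
  "'a::metric_space set \<Rightarrow> real \<Rightarrow> (('a \<Rightarrow> real) \<times> ('a \<Rightarrow> real)) set" where
  "strong_entourage B \<epsilon> =
     {(f, g). f \<in> cont_funs \<and> g \<in> cont_funs \<and>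
        (\<exists>\<delta>>0. \<forall>x\<in>enlargement B \<delta>. \<bar>f x - g x\<bar> < \<epsilon>)}"

definition strong_uniformity ::
  "'a::metric_space set set \<Rightarrow> (('a \<Rightarrow> real) \<times> ('a \<Rightarrow> real)) set set" where
  "strong_uniformity \<BB> =
     {E. E \<subseteq> cont_funs \<times> cont_funs \<and> (\<exists>B\<in>\<BB>. \<exists>\<epsilon>>0. strong_entourage B \<epsilon> \<subseteq> E)}"

definition strong_open :: "'a::metric_space set set \<Rightarrow> ('a \<Rightarrow> real) set \<Rightarrow> bool" where
  "strong_open \<BB> W \<longleftrightarrow>
     W \<subseteq> cont_funs \<and> (\<forall>f\<in>W. \<exists>E\<in>strong_uniformity \<BB>. E `` {f} \<subseteq> W)"

definition strong_topology :: "'a::metric_space set set \<Rightarrow> ('a \<Rightarrow> real) topology" where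
  "strong_topology \<BB> = topology (strong_open \<BB>)"

lemma strong_entourage_mono:
  assumes "B \<subseteq> B'" and "\<epsilon>' \<le> \<epsilon>"
  shows "strong_entourage B' \<epsilon>' \<subseteq> strong_entourage B \<epsilon>"
proof -
  have sub: "enlargement B \<delta> \<subseteq> enlargement B' \<delta>" for \<delta>
    using assms(1) by (auto simp: enlargement_def)
  show ?thesis
  proof (rule subrelI)
    fix f g assume "(f, g) \<in> strong_entourage B' \<epsilon>'"
    then obtain \<delta> where fg: "f \<in> cont_funs" "g \<in> cont_funs" and \<delta>: "\<delta> > 0"
      and *: "\<forall>x\<in>enlargement B' \<delta>. \<bar>f x - g x\<bar> < \<epsilon>'"
      unfolding strong_entourage_def by blast
    have "\<bar>f x - g x\<bar> < \<epsilon>" if "x \<in> enlargement B \<delta>" for x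
      using *[rule_format, of x] sub[of \<delta>] that assms(2) by force
    with fg \<delta> show "(f, g) \<in> strong_entourage B \<epsilon>"
      unfolding strong_entourage_def by blast
  qed
qed

lemma strong_uniformity_Int:
  assumes "bornology \<BB>" and "E \<in> strong_uniformity \<BB>" and "F \<in> strong_uniformity \<BB>"
  shows "E \<inter> F \<in> strong_uniformity \<BB>"
proof -
  obtain A a where A: "A \<in> \<BB>" "a > 0" "strong_entourage A a \<subseteq> E"
    using assms(2) by (auto simp: strong_uniformity_def)
  obtain B b where B: "B \<in> \<BB>" "b > 0" "strong_entourage B b \<subseteq> F"
    using assms(3) by (auto simp: strong_uniformity_def)
  have "\<Union>{A, B} \<in> \<BB>"
    using assms(1)[unfolded bornology_def, THEN conjunct2, THEN conjunct1, rule_format, of "{A, B}"]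
      A(1) B(1) by simp
  then have AB: "A \<union> B \<in> \<BB>" by simp
  have "strong_entourage (A \<union> B) (min a b) \<subseteq> E \<inter> F"
    using A(3) B(3) strong_entourage_mono[of A "A \<union> B" "min a b" a]
      strong_entourage_mono[of B "A \<union> B" "min a b" b] by auto
  moreover have "min a b > 0" using A(2) B(2) by simp
  moreover have "E \<inter> F \<subseteq> cont_funs \<times> cont_funs"
    using assms(2) by (auto simp: strong_uniformity_def)
  ultimately have "E \<inter> F \<subseteq> cont_funs \<times> cont_funs \<and>
      (\<exists>B\<in>\<BB>. \<exists>\<epsilon>>0. strong_entourage B \<epsilon> \<subseteq> E \<inter> F)"
    using AB by (intro conjI bexI[of _ "A \<union> B"] exI[of _ "min a b"])
  then show ?thesis by (simp only: strong_uniformity_def mem_Collect_eq)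
qed

lemma istopology_strong_open:
  assumes "bornology \<BB>"
  shows "istopology (strong_open \<BB>)"
  unfolding istopology_def
proof (intro conjI allI impI)
  fix S T assume S: "strong_open \<BB> S" and T: "strong_open \<BB> T"
  show "strong_open \<BB> (S \<inter> T)"
    unfolding strong_open_def
  proof (intro conjI ballI)
    show "S \<inter> T \<subseteq> cont_funs" using S by (auto simp: strong_open_def)
    fix f assume "f \<in> S \<inter> T"
    then obtain E F where "E \<in> strong_uniformity \<BB>" "E `` {f} \<subseteq> S"
      "F \<in> strong_uniformity \<BB>" "F `` {f} \<subseteq> T"
      using S T unfolding strong_open_def by blast
    then show "\<exists>E\<in>strong_uniformity \<BB>. E `` {f} \<subseteq> S \<inter> T"
      using strong_uniformity_Int[OF assms] by (intro bexI[of _ "E \<inter> F"]) auto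
  qed
next
  fix \<K> assume K: "\<forall>K\<in>\<K>. strong_open \<BB> K"
  show "strong_open \<BB> (\<Union>\<K>)"
    unfolding strong_open_def
  proof (intro conjI ballI)
    show "\<Union>\<K> \<subseteq> cont_funs" using K by (auto simp: strong_open_def)
    fix f assume "f \<in> \<Union>\<K>"
    then obtain K where K': "K \<in> \<K>" "f \<in> K" by blast
    then obtain E where "E \<in> strong_uniformity \<BB>" "E `` {f} \<subseteq> K"
      using K unfolding strong_open_def by blast
    then show "\<exists>E\<in>strong_uniformity \<BB>. E `` {f} \<subseteq> \<Union>\<K>" using K'(1) by blast
  qed
qed

lemma openin_strong_topology:
  "bornology \<BB> \<Longrightarrow> openin (strong_topology \<BB>) W \<longleftrightarrow> strong_open \<BB> W"
  by (simp add: strong_topology_def istopology_strong_open)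

lemma topspace_strong_topology:
  assumes "bornology \<BB>"
  shows "topspace (strong_topology \<BB>) = cont_funs"
proof
  show "topspace (strong_topology \<BB>) \<subseteq> cont_funs"
    using assms openin_topspace openin_strong_topology strong_open_def by blast
  have "{} \<in> \<BB>"
    using assms[unfolded bornology_def, THEN conjunct2, THEN conjunct1, rule_format, of "{}"]
    by simp
  moreover have "strong_entourage {} 1 \<subseteq> cont_funs \<times> cont_funs"
    by (auto simp: strong_entourage_def)
  ultimately have "(cont_funs :: ('a \<Rightarrow> real) set) \<times> cont_funs \<in> strong_uniformity \<BB>"
    unfolding strong_uniformity_def using zero_less_one by blast
  moreover have "(cont_funs \<times> cont_funs) `` {f} \<subseteq> cont_funs" for f :: "'a \<Rightarrow> real"
    by auto
  ultimately have "strong_open \<BB> cont_funs"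
    unfolding strong_open_def by (intro conjI ballI bexI) simp_all
  then show "cont_funs \<subseteq> topspace (strong_topology \<BB>)"
    using assms openin_strong_topology openin_subset by blast
qed


section \<open>Games\<close>

text \<open>
  A strategy \<open>\<sigma>\<close> of ONE maps the list of TWO's previous moves to ONE's next move.
  \<open>legal1 w\<close> says that ONE may play \<open>w\<close>, \<open>legal2 w m\<close> that TWO may answer \<open>w\<close> by \<open>m\<close>,
  and \<open>win1 m\<close> that ONE wins the run in which TWO plays the sequence \<open>m\<close>
  (in all four games below the outcome depends only on TWO's moves).
  The strategy need only be legal at positions reached by legal answers of TWO.
\<close>

definition ONE_has_winning_strategy ::
  "('w \<Rightarrow> bool) \<Rightarrow> ('w \<Rightarrow> 'm \<Rightarrow> bool) \<Rightarrow> ((nat \<Rightarrow> 'm) \<Rightarrow> bool) \<Rightarrow> bool" where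
  "ONE_has_winning_strategy legal1 legal2 win1 \<longleftrightarrow>
     (\<exists>\<sigma> :: 'm list \<Rightarrow> 'w.
        (\<forall>h. (\<forall>i<length h. legal2 (\<sigma> (take i h)) (h ! i)) \<longrightarrow> legal1 (\<sigma> h)) \<and>
        (\<forall>m. (\<forall>n. legal2 (\<sigma> (map m [0..<n])) (m n)) \<longrightarrow> win1 m))"

definition ONE_wins_G :: "'a::metric_space set set \<Rightarrow> bool" where
  "ONE_wins_G \<BB> \<longleftrightarrow>
     ONE_has_winning_strategy
       (\<lambda>W. openin (strong_topology \<BB>) W \<and> (\<lambda>_. 0) \<in> W)
       (\<lambda>W f. f \<in> W)
       (\<lambda>f. limitin (strong_topology \<BB>) f (\<lambda>_. 0) sequentially)"

definition ONE_wins_CL :: "'a::metric_space set set \<Rightarrow> bool" where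
  "ONE_wins_CL \<BB> \<longleftrightarrow>
     ONE_has_winning_strategy
       (\<lambda>W. openin (strong_topology \<BB>) W \<and> W \<noteq> {})
       (\<lambda>W f. f \<in> W)
       (\<lambda>f. (\<lambda>_. 0) \<in> strong_topology \<BB> closure_of range f)"

definition closed_discrete_in :: "'b topology \<Rightarrow> 'b set \<Rightarrow> bool" where
  "closed_discrete_in T D \<longleftrightarrow> closedin T D \<and> subtopology T D = discrete_topology D"

definition ONE_wins_CD :: "'a::metric_space set set \<Rightarrow> bool" where
  "ONE_wins_CD \<BB> \<longleftrightarrow>
     ONE_has_winning_strategy
       (\<lambda>W. openin (strong_topology \<BB>) W \<and> W \<noteq> {})
       (\<lambda>W f. f \<in> W)
       (\<lambda>f. \<not> closed_discrete_in (strong_topology \<BB>) (range f))"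

definition open_strong_cover :: "'a::metric_space set set \<Rightarrow> 'a set set \<Rightarrow> bool" where
  "open_strong_cover \<BB> \<U> \<longleftrightarrow>
     (\<forall>U\<in>\<U>. open U) \<and> \<Union>\<U> = UNIV \<and> UNIV \<notin> \<U> \<and>
     (\<forall>B\<in>\<BB>. \<exists>U\<in>\<U>. \<exists>\<delta>>0. enlargement B \<delta> \<subseteq> U)"

definition ONE_wins_O :: "'a::metric_space set set \<Rightarrow> bool" where
  "ONE_wins_O \<BB> \<longleftrightarrow>
     ONE_has_winning_strategy
       (\<lambda>B. B \<in> \<BB>)
       (\<lambda>B U. open U \<and> U \<noteq> UNIV \<and> (\<exists>\<delta>>0. enlargement B \<delta> \<subseteq> U))
       (\<lambda>U. open_strong_cover \<BB> (range U))"

end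

(*
  Since the bornology has a compact base, the strong topology is the topology of uniform
  convergence on the compact members K of the bornology, and U contains an enlargement of K as soon
  as it contains K.

  (4) implies (1): if ONE answers each history by the union of the moves of a winning strategy on
  all subsequences of that history, then every compact member is contained in all but finitely many
  of TWO's sets, because the indices that fail would form a losing play. Functions f_n are
  translated to the sets {|f_n| < 1/(n+1)}; such a set may be the whole space, which is illegal for
  TWO, but then its index does not fail.

  (1) implies (2) is immediate, and (2) implies (3) because ONE may remove 0 from its moves: they
  remain open and nonempty, and then 0 is a limit of the range without belonging to it.

  (3) implies (4): an answer U_n of TWO to a compact set K_n is translated to a function f_n that
  agrees with the centre of a basic neighbourhood on K_n and equals n outside U_n. If some K is in
  no U_n, then f_n takes the value n on K, so the f_n form a locally finite family.
*)
theory Submission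
  imports Defs "HOL-Library.Sublist"
begin

section \<open>Strategies\<close>

text \<open>Where \<open>\<sigma>\<close> is illegal, ONE may play the default \<open>d\<close>:
  such positions are never reached while TWO answers legally, so no run that matters changes. Later
  constructions can then assume legality at every history.\<close>

lemma ONE_has_winning_strategy_iff_total:
  assumes "legal1 d"
  shows "ONE_has_winning_strategy legal1 legal2 win1 \<longleftrightarrow>
    (\<exists>\<sigma>. (\<forall>h. legal1 (\<sigma> h)) \<and> (\<forall>m. (\<forall>n. legal2 (\<sigma> (map m [0..<n])) (m n)) \<longrightarrow> win1 m))"
    (is "?L \<longleftrightarrow> ?R")
proof
  assume ?L
  then obtain \<sigma> where legal: "\<And>h. (\<forall>i<length h. legal2 (\<sigma> (take i h)) (h ! i)) \<Longrightarrow> legal1 (\<sigma> h)"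
    and win: "\<And>m. (\<forall>n. legal2 (\<sigma> (map m [0..<n])) (m n)) \<Longrightarrow> win1 m"
    unfolding ONE_has_winning_strategy_def by blast
  define \<tau> where "\<tau> h = (if legal1 (\<sigma> h) then \<sigma> h else d)" for h
  have "win1 m" if m: "\<forall>n. legal2 (\<tau> (map m [0..<n])) (m n)" for m
  proof (rule win, rule allI)
    fix n
    show "legal2 (\<sigma> (map m [0..<n])) (m n)"
    \<comment> \<open>If the earlier rounds are legal against \<open>\<sigma>\<close>, its next move
      is legal, so \<open>\<tau>\<close> agrees with it in this round too.\<close>
    proof (induction n rule: less_induct)
      case (less n)
      have "legal1 (\<sigma> (map m [0..<n]))"
        by (rule legal) (use less in \<open>simp add: take_map\<close>)
      then show ?case using m[rule_format, of n] by (simp add: \<tau>_def)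
    qed
  qed
  moreover have "legal1 (\<tau> h)" for h using assms by (simp add: \<tau>_def)
  ultimately show ?R by blast
next
  assume ?R
  then obtain \<sigma> where "\<forall>h. legal1 (\<sigma> h)"
    and "\<forall>m. (\<forall>n. legal2 (\<sigma> (map m [0..<n])) (m n)) \<longrightarrow> win1 m"
    by (elim exE conjE)
  then show ?L
    unfolding ONE_has_winning_strategy_def by (intro exI[of _ \<sigma>] conjI) simp_all
qed

lemma ONE_has_winning_strategyE:
  assumes "ONE_has_winning_strategy legal1 legal2 win1" and "legal1 d"
  obtains \<sigma> where "\<And>h. legal1 (\<sigma> h)"
    and "\<And>m. (\<And>n. legal2 (\<sigma> (map m [0..<n])) (m n)) \<Longrightarrow> win1 m"
proof -
  from assms(1) obtain \<sigma> where "\<forall>h. legal1 (\<sigma> h)"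
    and "\<forall>m. (\<forall>n. legal2 (\<sigma> (map m [0..<n])) (m n)) \<longrightarrow> win1 m"
    unfolding ONE_has_winning_strategy_iff_total[of legal1, OF assms(2)] by (elim exE conjE)
  then show thesis by (intro that[of \<sigma>]) simp_all
qed

lemma ONE_has_winning_strategyI:
  assumes "\<And>h. legal1 (\<sigma> h)"
    and "\<And>m. (\<And>n. legal2 (\<sigma> (map m [0..<n])) (m n)) \<Longrightarrow> win1 m"
  shows "ONE_has_winning_strategy legal1 legal2 win1"
  unfolding ONE_has_winning_strategy_def by (intro exI[of _ \<sigma>] conjI allI impI assms) simp

text \<open>Lets a play along selected rounds be compared with the full history: what was selected
  before step \<open>k\<close> is found among the first \<open>r k\<close> moves.\<close>

lemma subseq_map_strict_mono:
  assumes "strict_mono r"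
  shows "subseq (map (m \<circ> r) [0..<k]) (map m [0..<r k])"
proof (induction k)
  case (Suc k)
  have "Suc (r k) \<le> r (Suc k)"
    using assms by (simp add: Suc_le_eq strict_mono_def)
  then have "[0..<r (Suc k)] = [0..<Suc (r k)] @ [Suc (r k)..<r (Suc k)]"
    by (metis le_iff_add upt_add_eq_append zero_le)
  then have "prefix (map m [0..<Suc (r k)]) (map m [0..<r (Suc k)])"
    by (auto simp: prefix_def)
  moreover have "subseq (map (m \<circ> r) [0..<Suc k]) (map m [0..<Suc (r k)])"
    using Suc by (simp add: comp_def)
  ultimately show ?case by (meson prefix_imp_subseq subseq_order.order_trans)
qed simp

text \<open>In a T1 space every neighbourhood of an accumulation point of \<open>D\<close> meets
  \<open>D\<close> in an infinite set, so local finiteness leaves the derived set empty.\<close>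

lemma closed_discrete_in_locally_finite:
  assumes "t1_space T" and "D \<subseteq> topspace T"
    and "\<And>x. x \<in> topspace T \<Longrightarrow> \<exists>V. openin T V \<and> x \<in> V \<and> finite (D \<inter> V)"
  shows "closed_discrete_in T D"
proof -
  have "T derived_set_of D = {}"
    using assms t1_space_derived_set_of_infinite_openin[of T] by blast
  then show ?thesis
    unfolding closed_discrete_in_def closedin_contains_derived_set
      subtopology_eq_discrete_topology_eq
    using assms(2) by simp
qed

section \<open>Compact sets and uniform balls\<close>

text \<open>\<open>\<delta>\<close> is a Lebesgue number of the one-member cover \<open>{U}\<close>
  of \<open>K\<close>.\<close>

lemma compact_enlargement_subset_open:
  assumes "compact K" "open U" "K \<subseteq> U"
  obtains \<delta> where "\<delta> > 0" "enlargement K \<delta> \<subseteq> U"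
proof -
  obtain e where "e > 0" "\<forall>x\<in>K. \<exists>G\<in>{U}. ball x e \<subseteq> G"
    using Heine_Borel_lemma[of K "{U}"] assms by (metis Union_insert Union_empty sup_bot_right singletonD)
  then show thesis by (intro that[of e]) (auto simp: enlargement_def)
qed

lemma subset_enlargement: "\<delta> > 0 \<Longrightarrow> B \<subseteq> enlargement B \<delta>"
  by (auto simp: enlargement_def)

text \<open>Compactness keeps \<open>K\<close> at positive distance from the complement of
  \<open>U\<close>, so the truncated, rescaled distance to that complement is a weight equal to 1 on
  \<open>K\<close> and 0 off \<open>U\<close>. Since \<open>infdist\<close> to the empty set is 0,
  the weight on \<open>K\<close> relies on \<open>U \<noteq> UNIV\<close>.\<close>

lemma continuous_interpolation_compact_open:
  fixes f :: "'a::metric_space \<Rightarrow> real"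
  assumes "compact K" "open U" "K \<subseteq> U" "U \<noteq> UNIV" "continuous_on UNIV f"
  obtains g where "continuous_on UNIV g" "\<And>x. x \<in> K \<Longrightarrow> g x = f x" "\<And>x. x \<notin> U \<Longrightarrow> g x = c"
proof -
  obtain \<delta> where \<delta>: "\<delta> > 0" "enlargement K \<delta> \<subseteq> U"
    using compact_enlargement_subset_open assms by metis
  define h where "h x = min 1 (infdist x (- U) / \<delta>)" for x
  have h1: "h x = 1" if "x \<in> K" for x
  proof -
    have "\<delta> \<le> dist x y" if "y \<in> - U" for y
      using \<delta> \<open>x \<in> K\<close> that by (force simp: enlargement_def not_less)
    then have "\<delta> \<le> infdist x (- U)"
      using assms(4) by (auto simp: infdist_def intro!: cINF_greatest)
    then show ?thesis using \<delta>(1) by (simp add: h_def)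
  qed
  have "continuous_on UNIV (\<lambda>x. c + h x * (f x - c))"
    unfolding h_def using assms(5) \<delta>(1) by (intro continuous_intros) auto
  moreover have "h x = 0" if "x \<notin> U" for x
    using that by (simp add: h_def)
  ultimately show thesis using h1 by (intro that[of "\<lambda>x. c + h x * (f x - c)"]) auto
qed

text \<open>The bound is imposed on \<open>K\<close> itself, without an enlargement; for compact
  \<open>K\<close> and continuous \<open>f\<close> this is no weaker than the section of the strong
  entourage.\<close>

definition unif_ball :: "'a::metric_space set \<Rightarrow> real \<Rightarrow> ('a \<Rightarrow> real) \<Rightarrow> ('a \<Rightarrow> real) set" where
  "unif_ball K \<epsilon> f = {g \<in> cont_funs. \<forall>x\<in>K. \<bar>f x - g x\<bar> < \<epsilon>}"

text \<open>For continuous functions the strict bound holds on an open set; containing the compact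
  \<open>K\<close>, that set contains an enlargement of \<open>K\<close>.\<close>

lemma unif_ball_subset_entourage:
  assumes "compact K" "B \<subseteq> K" "f \<in> cont_funs"
  shows "unif_ball K \<epsilon> f \<subseteq> strong_entourage B \<epsilon> `` {f}"
proof
  fix g assume g: "g \<in> unif_ball K \<epsilon> f"
  then have "open {x. \<bar>f x - g x\<bar> < \<epsilon>}" "K \<subseteq> {x. \<bar>f x - g x\<bar> < \<epsilon>}"
    using assms by (auto simp: unif_ball_def cont_funs_def intro!: open_Collect_less continuous_intros)
  then obtain \<delta> where "\<delta> > 0" "enlargement K \<delta> \<subseteq> {x. \<bar>f x - g x\<bar> < \<epsilon>}"
    using compact_enlargement_subset_open assms(1) by metis
  moreover have "enlargement B \<delta> \<subseteq> enlargement K \<delta>"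
    using assms(2) by (auto simp: enlargement_def)
  ultimately show "g \<in> strong_entourage B \<epsilon> `` {f}"
    using g assms(3) by (auto simp: strong_entourage_def unif_ball_def)
qed

lemma entourage_subset_unif_ball: "strong_entourage B \<epsilon> `` {f} \<subseteq> unif_ball B \<epsilon> f"
  using subset_enlargement by (fastforce simp: strong_entourage_def unif_ball_def)

text \<open>The difference attains its maximum on \<open>K\<close>, strictly below
  \<open>\<epsilon>\<close>, and the remaining slack serves as \<open>\<eta>\<close>. This makes
  uniform balls open.\<close>

lemma unif_ball_absorb:
  assumes "compact K" "f \<in> cont_funs" "g \<in> unif_ball K \<epsilon> f"
  obtains \<eta> where "\<eta> > 0" "unif_ball K \<eta> g \<subseteq> unif_ball K \<epsilon> f"
proof (cases "K = {}")
  case True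
  then show thesis by (intro that[of 1]) (auto simp: unif_ball_def)
next
  case False
  have "continuous_on K (\<lambda>x. \<bar>f x - g x\<bar>)"
    using assms(2,3) unfolding unif_ball_def cont_funs_def
    by (intro continuous_intros) (auto intro: continuous_on_subset)
  then obtain z where z: "z \<in> K" "\<forall>x\<in>K. \<bar>f x - g x\<bar> \<le> \<bar>f z - g z\<bar>"
    using continuous_attains_sup[OF assms(1) False] by blast
  show thesis
  proof (rule that)
    show "\<epsilon> - \<bar>f z - g z\<bar> > 0" using assms(3) z by (auto simp: unif_ball_def)
    show "unif_ball K (\<epsilon> - \<bar>f z - g z\<bar>) g \<subseteq> unif_ball K \<epsilon> f"
      using z unfolding unif_ball_def by fastforce
  qed
qed

section \<open>Bornologies with a compact base\<close>

locale compact_bornology =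
  fixes \<BB> :: "'a::metric_space set set"
  assumes born: "bornology \<BB>" and cbase: "has_compact_base \<BB>"
begin

lemma compact_superset:
  assumes "B \<in> \<BB>"
  obtains K where "K \<in> \<BB>" "compact K" "B \<subseteq> K"
proof -
  obtain \<BB>\<^sub>0 where "bornology_base \<BB> \<BB>\<^sub>0" and compact: "\<forall>K\<in>\<BB>\<^sub>0. compact K"
    using cbase by (auto simp: has_compact_base_def)
  then have sub: "\<BB>\<^sub>0 \<subseteq> \<BB>" and "\<exists>K\<in>\<BB>\<^sub>0. B \<subseteq> K"
    using assms by (simp_all add: bornology_base_def)
  then obtain K where "K \<in> \<BB>\<^sub>0" "B \<subseteq> K" by blast
  then show thesis using compact sub by (intro that[of K]) auto
qed

lemma Union_in: "\<F> \<subseteq> \<BB> \<Longrightarrow> finite \<F> \<Longrightarrow> \<Union>\<F> \<in> \<BB>"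
  using born by (simp add: bornology_def)

lemma empty_in: "{} \<in> \<BB>"
  using Union_in[of "{}"] by simp

lemma singleton_in: "{x} \<in> \<BB>"
proof -
  obtain B where "B \<in> \<BB>" "x \<in> B" using born by (metis UNIV_I UnionE bornology_def)
  moreover have "\<forall>A\<subseteq>B. A \<in> \<BB>" using born \<open>B \<in> \<BB>\<close> by (simp add: bornology_def)
  ultimately show ?thesis by simp
qed

text \<open>Every member of the bornology lies in a compact one, where uniform balls and sections of
  entourages coincide, so enlargements disappear from the topology.\<close>

lemma openin_strong_iff_unif_ball:
  "openin (strong_topology \<BB>) W \<longleftrightarrow>
     W \<subseteq> cont_funs \<and> (\<forall>f\<in>W. \<exists>K\<in>\<BB>. compact K \<and> (\<exists>\<epsilon>>0. unif_ball K \<epsilon> f \<subseteq> W))"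
    (is "?L \<longleftrightarrow> ?R")
proof
  assume ?L
  then have W: "strong_open \<BB> W" by (simp add: openin_strong_topology born)
  show ?R
  proof (intro conjI ballI)
    show sub: "W \<subseteq> cont_funs" using W by (simp add: strong_open_def)
    fix f assume f: "f \<in> W"
    then obtain E where "E \<in> strong_uniformity \<BB>" "E `` {f} \<subseteq> W"
      using W by (auto simp: strong_open_def)
    then obtain B \<epsilon> where B: "B \<in> \<BB>" "\<epsilon> > 0" "strong_entourage B \<epsilon> `` {f} \<subseteq> W"
      unfolding strong_uniformity_def by blast
    obtain K where "K \<in> \<BB>" "compact K" "B \<subseteq> K" using compact_superset B(1) by blast
    then show "\<exists>K\<in>\<BB>. compact K \<and> (\<exists>\<epsilon>>0. unif_ball K \<epsilon> f \<subseteq> W)"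
      using unif_ball_subset_entourage[of K B f \<epsilon>] f sub B by blast
  qed
next
  assume R: ?R
  have "\<exists>E\<in>strong_uniformity \<BB>. E `` {f} \<subseteq> W" if "f \<in> W" for f
  proof -
    obtain K \<epsilon> where K: "K \<in> \<BB>" "\<epsilon> > 0" "unif_ball K \<epsilon> f \<subseteq> W" using R \<open>f \<in> W\<close> by blast
    then have "strong_entourage K \<epsilon> \<in> strong_uniformity \<BB>"
      by (auto simp: strong_uniformity_def strong_entourage_def)
    then show ?thesis using K entourage_subset_unif_ball by blast
  qed
  then show ?L using R by (simp add: openin_strong_topology born strong_open_def)
qed

lemma openin_unif_ball:
  assumes "K \<in> \<BB>" "compact K" "f \<in> cont_funs"
  shows "openin (strong_topology \<BB>) (unif_ball K \<epsilon> f)"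
  unfolding openin_strong_iff_unif_ball
proof (intro conjI ballI)
  show "unif_ball K \<epsilon> f \<subseteq> cont_funs" by (auto simp: unif_ball_def)
  fix g assume "g \<in> unif_ball K \<epsilon> f"
  then show "\<exists>K'\<in>\<BB>. compact K' \<and> (\<exists>\<eta>>0. unif_ball K' \<eta> g \<subseteq> unif_ball K \<epsilon> f)"
    using unif_ball_absorb[OF assms(2,3)] assms by metis
qed

lemma topspace_strong: "topspace (strong_topology \<BB>) = cont_funs"
  using topspace_strong_topology born by blast

text \<open>Singletons are compact members of the bornology, so evaluation at one point separates
  two functions.\<close>

lemma t1_space_strong: "t1_space (strong_topology \<BB>)"
  unfolding t1_space_closedin_singleton topspace_strong
proof
  fix f :: "'a \<Rightarrow> real" assume f: "f \<in> cont_funs"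
  have "openin (strong_topology \<BB>) (cont_funs - {f})"
    unfolding openin_strong_iff_unif_ball
  proof (intro conjI ballI)
    fix g assume g: "g \<in> cont_funs - {f}"
    then obtain x where x: "g x \<noteq> f x" by (metis Diff_iff ext singletonI)
    then have "unif_ball {x} \<bar>g x - f x\<bar> g \<subseteq> cont_funs - {f}" by (auto simp: unif_ball_def)
    then show "\<exists>K\<in>\<BB>. compact K \<and> (\<exists>\<epsilon>>0. unif_ball K \<epsilon> g \<subseteq> cont_funs - {f})"
      using x singleton_in by (metis compact_insert compact_empty right_minus_eq zero_less_abs_iff)
  qed blast
  then show "closedin (strong_topology \<BB>) {f}"
    using f by (simp add: closedin_def topspace_strong)
qed

text \<open>Adding the constant \<open>\<epsilon> / 2\<close> to a member of \<open>W\<close> gives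
  a second member.\<close>

lemma openin_strong_not_singleton:
  assumes "openin (strong_topology \<BB>) W" "W \<noteq> {}"
  shows "W - {f} \<noteq> {}"
proof -
  obtain g where g: "g \<in> W" using assms by blast
  then obtain K \<epsilon> where K: "\<epsilon> > 0" "unif_ball K \<epsilon> g \<subseteq> W" "g \<in> cont_funs"
    using assms unfolding openin_strong_iff_unif_ball by blast
  then have "(\<lambda>x. g x + \<epsilon> / 2) \<in> unif_ball K \<epsilon> g"
    by (auto simp: unif_ball_def cont_funs_def intro!: continuous_intros)
  moreover have "(\<lambda>x. g x + \<epsilon> / 2) \<noteq> g" using K(1) by (auto dest: fun_cong)
  ultimately show ?thesis using g K(2) by auto
qed

lemma zero_in_cont_funs: "(\<lambda>_. 0) \<in> (cont_funs :: ('a \<Rightarrow> real) set)"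
  by (simp add: cont_funs_def)

lemma openin_cont_funs: "openin (strong_topology \<BB>) cont_funs"
  by (metis openin_topspace topspace_strong)

text \<open>Singletons of the bornology yield the covering of the space, and compactness turns plain
  inclusion into inclusion of an enlargement.\<close>

lemma open_strong_cover_iff:
  "open_strong_cover \<BB> \<U> \<longleftrightarrow>
     (\<forall>U\<in>\<U>. open U \<and> U \<noteq> UNIV) \<and> (\<forall>K\<in>\<BB>. compact K \<longrightarrow> (\<exists>U\<in>\<U>. K \<subseteq> U))" (is "?L \<longleftrightarrow> ?R")
proof
  assume ?L
  then have "\<exists>U\<in>\<U>. K \<subseteq> U" if "K \<in> \<BB>" for K
    using that subset_enlargement[of _ K] unfolding open_strong_cover_def by blast
  then show ?R using \<open>?L\<close> by (auto simp: open_strong_cover_def)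
next
  assume R: ?R
  have "x \<in> \<Union>\<U>" for x
    using R singleton_in[of x] by (meson UnionI compact_sing insert_subset)
  moreover have "\<exists>U\<in>\<U>. \<exists>\<delta>>0. enlargement B \<delta> \<subseteq> U" if "B \<in> \<BB>" for B
  proof -
    obtain K where K: "K \<in> \<BB>" "compact K" "B \<subseteq> K" using compact_superset[OF \<open>B \<in> \<BB>\<close>] by blast
    then obtain U where U: "U \<in> \<U>" "K \<subseteq> U" using R by blast
    then have "open U" using R by blast
    then obtain \<delta> where "\<delta> > 0" "enlargement K \<delta> \<subseteq> U"
      using compact_enlargement_subset_open K(2) U(2) by blast
    moreover have "enlargement B \<delta> \<subseteq> enlargement K \<delta>"
      using K(3) by (auto simp: enlargement_def)
    ultimately show ?thesis using U(1) by blast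
  qed
  ultimately show ?L using R by (auto simp: open_strong_cover_def)
qed

section \<open>Implications between the games\<close>

lemma O_imp_G:
  assumes "ONE_wins_O \<BB>"
  shows "ONE_wins_G \<BB>"
proof -
  obtain \<sigma> where \<sigma>: "\<And>h. \<sigma> h \<in> \<BB>"
    and win: "\<And>U. (\<And>n. open (U n) \<and> U n \<noteq> UNIV \<and>
        (\<exists>\<delta>>0. enlargement (\<sigma> (map U [0..<n])) \<delta> \<subseteq> U n)) \<Longrightarrow> open_strong_cover \<BB> (range U)"
    using assms empty_in unfolding ONE_wins_O_def by (rule ONE_has_winning_strategyE) blast+
  \<comment> \<open>ONE must dominate the reply of \<open>\<sigma>\<close> to every selection of
    past moves, since the failing rounds are not known in advance. A finite list has finitely many
    subsequences, so the union stays in the bornology.\<close>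
  define S where "S Us = \<Union>(\<sigma> ` set (subseqs Us))" for Us
  have "S Us \<in> \<BB>" for Us
    unfolding S_def using \<sigma> by (intro Union_in) auto
  then have "\<exists>K. K \<in> \<BB> \<and> compact K \<and> S Us \<subseteq> K" for Us
    using compact_superset by metis
  then obtain K where K: "\<And>Us. K Us \<in> \<BB>" "\<And>Us. compact (K Us)" "\<And>Us. S Us \<subseteq> K Us"
    by metis
  \<comment> \<open>The thresholds tend to 0, so containing a set in all but finitely many of these
    sublevel sets means uniform convergence to 0 on it. \<open>Suc\<close> keeps round 0
    meaningful.\<close>
  define sub where "sub n f = {x. \<bar>f x\<bar> < 1 / real (Suc n)}" for n and f :: "'a \<Rightarrow> real"
  define \<tau> where "\<tau> fs =
    unif_ball (K (map (\<lambda>i. sub i (fs ! i)) [0..<length fs])) (1 / real (Suc (length fs))) (\<lambda>_. 0)" for fs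
  have conv: "limitin (strong_topology \<BB>) f (\<lambda>_. 0) sequentially"
    if f: "\<And>n. f n \<in> \<tau> (map f [0..<n])" for f
    unfolding limitin_def topspace_strong
  proof (intro conjI allI impI)
    define U where "U n = sub n (f n)" for n
    have fU: "f n \<in> unif_ball (K (map U [0..<n])) (1 / real (Suc n)) (\<lambda>_. 0)" for n
    proof -
      have "map (\<lambda>i. sub i (map f [0..<n] ! i)) [0..<n] = map U [0..<n]"
        by (simp add: U_def)
      then have "\<tau> (map f [0..<n]) = unif_ball (K (map U [0..<n])) (1 / real (Suc n)) (\<lambda>_. 0)"
        unfolding \<tau>_def by (simp only: length_map length_upt diff_zero)
      then show ?thesis using f[of n] by simp
    qed
    \<comment> \<open>With the same radius in \<open>\<tau>\<close> and in \<open>sub\<close>,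
      membership in the ball is precisely this inclusion for a continuous function.\<close>
    have KU: "K (map U [0..<n]) \<subseteq> U n" for n
      using fU[of n] by (auto simp: unif_ball_def U_def sub_def)
    have openU: "open (U n)" for n
      using fU[of n] unfolding U_def sub_def unif_ball_def cont_funs_def
      by (auto intro!: open_Collect_less continuous_intros)
    fix W assume "openin (strong_topology \<BB>) W \<and> (\<lambda>_. 0) \<in> W"
    then obtain L \<epsilon> where L: "L \<in> \<BB>" "compact L" "\<epsilon> > 0" "unif_ball L \<epsilon> (\<lambda>_. 0) \<subseteq> W"
      unfolding openin_strong_iff_unif_ball by blast
    obtain N where N: "1 / real (Suc N) < \<epsilon>"
      using L(3) nat_approx_posE by blast
    show "eventually (\<lambda>n. f n \<in> W) sequentially"
    proof (rule ccontr)
      assume "\<not> ?thesis"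
      then have "infinite {n. f n \<notin> W}"
        by (simp add: cofinite_eq_sequentially[symmetric] eventually_cofinite)
      \<comment> \<open>From round \<open>N\<close> on the threshold is below
        \<open>\<epsilon>\<close>, so failing to enter \<open>W\<close> forces failing to contain
        \<open>L\<close>.\<close>
      then have "infinite ({n. f n \<notin> W} - {..<N})" by simp
      then obtain r :: "nat \<Rightarrow> nat" where r: "strict_mono r" "\<And>k. r k \<in> {n. f n \<notin> W} - {..<N}"
        using infinite_enumerate by metis
      \<comment> \<open>Used twice: it shows that the selected sets differ from the whole space,
        hence are legal moves, and it contradicts the cover that they would form.\<close>
      have no: "\<not> L \<subseteq> U (r k)" for k
      proof
        assume *: "L \<subseteq> U (r k)"
        have "1 / real (Suc (r k)) \<le> 1 / real (Suc N)"
          using r(2)[of k] by (intro divide_left_mono) auto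
        then have "\<forall>x\<in>L. \<bar>f (r k) x\<bar> < \<epsilon>"
          using * N by (fastforce simp: U_def sub_def)
        then have "f (r k) \<in> unif_ball L \<epsilon> (\<lambda>_. 0)"
          using fU[of "r k"] by (simp add: unif_ball_def)
        then show False using L(4) r(2)[of k] by blast
      qed
      have "open_strong_cover \<BB> (range (U \<circ> r))"
      proof (rule win)
        fix k
        have "subseq (map (U \<circ> r) [0..<k]) (map U [0..<r k])"
          by (rule subseq_map_strict_mono) (rule r(1))
        then have "\<sigma> (map (U \<circ> r) [0..<k]) \<subseteq> S (map U [0..<r k])"
          unfolding S_def by (intro Union_upper imageI) simp
        also have "\<dots> \<subseteq> K (map U [0..<r k])" by (rule K)
        finally have sub: "\<sigma> (map (U \<circ> r) [0..<k]) \<subseteq> K (map U [0..<r k])" .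
        obtain \<delta> where "\<delta> > 0" "enlargement (K (map U [0..<r k])) \<delta> \<subseteq> U (r k)"
          using compact_enlargement_subset_open[OF K(2) openU KU] by blast
        then have "\<exists>\<delta>>0. enlargement (\<sigma> (map (U \<circ> r) [0..<k])) \<delta> \<subseteq> (U \<circ> r) k"
          using sub by (force simp: enlargement_def)
        then show "open ((U \<circ> r) k) \<and> (U \<circ> r) k \<noteq> UNIV \<and>
            (\<exists>\<delta>>0. enlargement (\<sigma> (map (U \<circ> r) [0..<k])) \<delta> \<subseteq> (U \<circ> r) k)"
          using openU no[of k] by auto
      qed
      then show False using no L(1,2) unfolding open_strong_cover_iff by auto
    qed
  qed (rule zero_in_cont_funs)
  have "openin (strong_topology \<BB>) (\<tau> fs) \<and> (\<lambda>_. 0) \<in> \<tau> fs" for fs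
  proof
    show "openin (strong_topology \<BB>) (\<tau> fs)"
      unfolding \<tau>_def by (intro openin_unif_ball K zero_in_cont_funs)
    show "(\<lambda>_. 0) \<in> \<tau> fs"
      using zero_in_cont_funs by (simp add: \<tau>_def unif_ball_def)
  qed
  then show ?thesis unfolding ONE_wins_G_def using conv by (rule ONE_has_winning_strategyI)
qed

text \<open>The same strategy serves: its moves contain 0, hence are nonempty, and a limit of the
  sequence lies in the closure of its range.\<close>

lemma G_imp_CL:
  assumes "ONE_wins_G \<BB>"
  shows "ONE_wins_CL \<BB>"
proof -
  \<comment> \<open>The whole space is the default move that makes the strategy total.\<close>
  have "openin (strong_topology \<BB>) cont_funs \<and> (\<lambda>_. 0) \<in> (cont_funs :: ('a \<Rightarrow> real) set)"
    using openin_cont_funs zero_in_cont_funs by blast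
  with assms obtain \<sigma> where
    \<sigma>: "\<And>h. openin (strong_topology \<BB>) (\<sigma> h) \<and> (\<lambda>_. 0) \<in> \<sigma> h"
    and win: "\<And>f. (\<And>n. f n \<in> \<sigma> (map f [0..<n])) \<Longrightarrow>
        limitin (strong_topology \<BB>) f (\<lambda>_. 0) sequentially"
    unfolding ONE_wins_G_def by (rule ONE_has_winning_strategyE) blast+
  show ?thesis
    unfolding ONE_wins_CL_def
  proof (rule ONE_has_winning_strategyI)
    show "openin (strong_topology \<BB>) (\<sigma> h) \<and> \<sigma> h \<noteq> {}" for h using \<sigma> by blast
    fix f assume "\<And>n. f n \<in> \<sigma> (map f [0..<n])"
    then have lim: "limitin (strong_topology \<BB>) f (\<lambda>_. 0) sequentially" by (rule win)
    have "\<exists>y\<in>range f. y \<in> T" if "(\<lambda>_. 0) \<in> T" "openin (strong_topology \<BB>) T" for T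
    proof -
      have "\<forall>\<^sub>F n in sequentially. f n \<in> T" using lim that by (simp add: limitin_def)
      then obtain n where "f n \<in> T" using eventually_happens'[OF sequentially_bot] by blast
      then show ?thesis by blast
    qed
    then show "(\<lambda>_. 0) \<in> strong_topology \<BB> closure_of range f"
      using zero_in_cont_funs by (auto simp: in_closure_of topspace_strong)
  qed
qed

lemma CL_imp_CD:
  assumes "ONE_wins_CL \<BB>"
  shows "ONE_wins_CD \<BB>"
proof -
  have "openin (strong_topology \<BB>) cont_funs \<and> (cont_funs :: ('a \<Rightarrow> real) set) \<noteq> {}"
    using openin_cont_funs zero_in_cont_funs by blast
  with assms obtain \<sigma> where
    \<sigma>: "\<And>h. openin (strong_topology \<BB>) (\<sigma> h) \<and> \<sigma> h \<noteq> {}"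
    and win: "\<And>f. (\<And>n. f n \<in> \<sigma> (map f [0..<n])) \<Longrightarrow>
        (\<lambda>_. 0) \<in> strong_topology \<BB> closure_of range f"
    unfolding ONE_wins_CL_def by (rule ONE_has_winning_strategyE) blast+
  have "closedin (strong_topology \<BB>) {\<lambda>_. 0}"
    using t1_space_strong zero_in_cont_funs by (simp add: t1_space_closedin_singleton topspace_strong)
  then have "openin (strong_topology \<BB>) (\<sigma> h - {\<lambda>_. 0}) \<and> \<sigma> h - {\<lambda>_. 0} \<noteq> {}" for h
    using \<sigma>[of h] openin_strong_not_singleton[of "\<sigma> h" "\<lambda>_. 0"] openin_diff by blast
  then show ?thesis
    unfolding ONE_wins_CD_def
  proof (rule ONE_has_winning_strategyI)
    fix f assume f: "\<And>n. f n \<in> \<sigma> (map f [0..<n]) - {\<lambda>_. 0}"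
    then have "(\<lambda>_. 0) \<in> strong_topology \<BB> closure_of range f" using win by blast
    moreover have "(\<lambda>_. 0) \<notin> range f" using f by (metis Diff_iff rangeE singletonI)
    ultimately show "\<not> closed_discrete_in (strong_topology \<BB>) (range f)"
      by (auto simp: closed_discrete_in_def closure_of_closedin)
  qed
qed

text \<open>A continuous \<open>g\<close> is bounded by some \<open>M\<close> on \<open>K\<close>,
  so \<open>f n\<close> can be within 1 of \<open>g\<close> on \<open>K\<close> only if
  \<open>n \<le> M + 1\<close>; the family is thus locally finite.\<close>

lemma diverging_functions_closed_discrete:
  fixes f :: "nat \<Rightarrow> 'a \<Rightarrow> real"
  assumes K: "K \<in> \<BB>" "compact K" and cont: "\<And>n. f n \<in> cont_funs"
    and val: "\<And>n. \<exists>x\<in>K. f n x = real n"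
  shows "closed_discrete_in (strong_topology \<BB>) (range f)"
proof (rule closed_discrete_in_locally_finite)
  fix g assume "g \<in> topspace (strong_topology \<BB>)"
  then have g: "g \<in> cont_funs" by (simp add: topspace_strong)
  then have "compact (g ` K)"
    using K(2) by (auto simp: cont_funs_def intro: compact_continuous_image continuous_on_subset)
  then obtain M where M: "\<And>x. x \<in> K \<Longrightarrow> \<bar>g x\<bar> \<le> M"
    by (metis compact_imp_bounded bounded_iff imageI real_norm_def)
  have "range f \<inter> unif_ball K 1 g \<subseteq> f ` {..nat \<lceil>M + 1\<rceil>}"
  proof
    fix h assume h: "h \<in> range f \<inter> unif_ball K 1 g"
    then obtain n where n: "h = f n" by blast
    obtain x where x: "x \<in> K" "f n x = real n" using val by blast
    have "\<bar>g x - f n x\<bar> < 1" using h n x(1) by (simp add: unif_ball_def)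
    then have "real n \<le> M + 1" using x M[of x] by linarith
    then have "n \<le> nat \<lceil>M + 1\<rceil>" by linarith
    then show "h \<in> f ` {..nat \<lceil>M + 1\<rceil>}" using n by simp
  qed
  then have "finite (range f \<inter> unif_ball K 1 g)" by (rule finite_subset) simp
  moreover have "g \<in> unif_ball K 1 g" using g by (simp add: unif_ball_def)
  ultimately show "\<exists>V. openin (strong_topology \<BB>) V \<and> g \<in> V \<and> finite (range f \<inter> V)"
    using openin_unif_ball[OF K g] by blast
qed (use cont t1_space_strong in \<open>auto simp: topspace_strong\<close>)

lemma CD_imp_O:
  assumes "ONE_wins_CD \<BB>"
  shows "ONE_wins_O \<BB>"
proof -
  have "openin (strong_topology \<BB>) cont_funs \<and> (cont_funs :: ('a \<Rightarrow> real) set) \<noteq> {}"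
    using openin_cont_funs zero_in_cont_funs by blast
  with assms obtain \<sigma> where
    \<sigma>: "\<And>h. openin (strong_topology \<BB>) (\<sigma> h) \<and> \<sigma> h \<noteq> {}"
    and win: "\<And>f. (\<And>n. f n \<in> \<sigma> (map f [0..<n])) \<Longrightarrow>
        \<not> closed_discrete_in (strong_topology \<BB>) (range f)"
    unfolding ONE_wins_CD_def by (rule ONE_has_winning_strategyE) blast+
  \<comment> \<open>\<open>K\<close> carries a uniform ball inside \<open>\<sigma> fs\<close>;
    changing its centre off \<open>K\<close> does not leave the ball. The length of the history is
    the round number, prescribed as the value off \<open>U\<close>.\<close>
  have "\<exists>K\<in>\<BB>. \<forall>U. open U \<and> U \<noteq> UNIV \<and> K \<subseteq> U \<longrightarrow> (\<exists>f\<in>\<sigma> fs. \<forall>x. x \<notin> U \<longrightarrow> f x = real (length fs))"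
    for fs
  proof -
    obtain f where f: "f \<in> \<sigma> fs" using \<sigma> by blast
    then obtain K \<epsilon> where K: "K \<in> \<BB>" "compact K" "\<epsilon> > 0" "unif_ball K \<epsilon> f \<subseteq> \<sigma> fs"
      and cont: "continuous_on UNIV f"
      using \<sigma>[of fs] unfolding openin_strong_iff_unif_ball cont_funs_def by blast
    have "\<exists>g\<in>\<sigma> fs. \<forall>x. x \<notin> U \<longrightarrow> g x = real (length fs)"
      if U: "open U" "U \<noteq> UNIV" "K \<subseteq> U" for U
    proof -
      obtain g where "continuous_on UNIV g" "\<And>x. x \<in> K \<Longrightarrow> g x = f x"
        and out: "\<And>x. x \<notin> U \<Longrightarrow> g x = real (length fs)"
        using continuous_interpolation_compact_open[OF K(2) U(1) U(3) U(2) cont] by blast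
      then have "g \<in> unif_ball K \<epsilon> f" using K(3) by (simp add: unif_ball_def cont_funs_def)
      then show ?thesis using K(4) out by blast
    qed
    then show ?thesis using K(1) by blast
  qed
  then obtain K where K: "\<And>fs. K fs \<in> \<BB>"
    and ex: "\<And>fs U. open U \<Longrightarrow> U \<noteq> UNIV \<Longrightarrow> K fs \<subseteq> U \<Longrightarrow>
      \<exists>f\<in>\<sigma> fs. \<forall>x. x \<notin> U \<longrightarrow> f x = real (length fs)"
    by metis
  define answer where "answer fs U =
    (SOME f. f \<in> \<sigma> fs \<and> (\<forall>x. x \<notin> U \<longrightarrow> f x = real (length fs)))" for fs U
  \<comment> \<open>Rebuilds the function history from TWO's sets; a left fold, because each answer
    depends on the functions chosen before it.\<close>
  define tr where "tr = foldl (\<lambda>fs U. fs @ [answer fs U]) []"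
  show ?thesis
    unfolding ONE_wins_O_def
  proof (rule ONE_has_winning_strategyI)
    show "K (tr Us) \<in> \<BB>" for Us by (rule K)
    fix U assume U: "\<And>n. open (U n) \<and> U n \<noteq> UNIV \<and>
      (\<exists>\<delta>>0. enlargement (K (tr (map U [0..<n]))) \<delta> \<subseteq> U n)"
    define f where "f n = answer (tr (map U [0..<n])) (U n)" for n
    have tr: "tr (map U [0..<n]) = map f [0..<n]" for n
      by (induction n) (simp_all add: tr_def f_def)
    have f: "f n \<in> \<sigma> (map f [0..<n]) \<and> (\<forall>x. x \<notin> U n \<longrightarrow> f n x = real n)" for n
    proof -
      have "K (map f [0..<n]) \<subseteq> U n"
        using U[of n] subset_enlargement unfolding tr by (meson order_trans)
      moreover have "open (U n)" "U n \<noteq> UNIV" using U[of n] by simp_all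
      ultimately have "\<exists>g. g \<in> \<sigma> (map f [0..<n]) \<and>
          (\<forall>x. x \<notin> U n \<longrightarrow> g x = real (length (map f [0..<n])))"
        using ex[of "U n" "map f [0..<n]"] by blast
      from someI_ex[OF this] show ?thesis by (simp add: f_def[of n] tr answer_def)
    qed
    have cont: "f n \<in> cont_funs" for n
      using f[of n] \<sigma> unfolding openin_strong_iff_unif_ball by blast
    \<comment> \<open>Otherwise each \<open>U n\<close> misses a point of \<open>L\<close>, at which
      \<open>f n\<close> has the value \<open>n\<close>, and ONE would lose the run of
      functions.\<close>
    have "\<exists>n. L \<subseteq> U n" if L: "L \<in> \<BB>" "compact L" for L
    proof (rule ccontr)
      assume "\<nexists>n. L \<subseteq> U n"
      then have "\<exists>x\<in>L. f n x = real n" for n using f by blast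
      then have "closed_discrete_in (strong_topology \<BB>) (range f)"
        by (rule diverging_functions_closed_discrete[OF L cont])
      then show False using win f by blast
    qed
    then show "open_strong_cover \<BB> (range U)"
      using U by (auto simp: open_strong_cover_iff)
  qed
qed

end

theorem theorem5p9:
  fixes \<BB> :: "'a::metric_space set set"
  assumes "infinite (UNIV :: 'a set)"
    and "bornology \<BB>"
    and "has_compact_base \<BB>"
    and "UNIV \<notin> \<BB>"
  shows "(ONE_wins_G \<BB> \<longleftrightarrow> ONE_wins_CL \<BB>) \<and>
         (ONE_wins_CL \<BB> \<longleftrightarrow> ONE_wins_CD \<BB>) \<and>
         (ONE_wins_CD \<BB> \<longleftrightarrow> ONE_wins_O \<BB>)"
proof -
  interpret compact_bornology \<BB> using assms by unfold_locales
  show ?thesis using O_imp_G G_imp_CL CL_imp_CD CD_imp_O by blast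
qed

end
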